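(* Let $X:\Phi'\to\Phi'$ be a Borel vector field and $\beta>0$. The set of $(\beta,X)$-KMS states is a convex subset of the set $\mathfrak{P}(\Phi')$ of Borel probability measures on $\Phi'$.
   Context: $H$ is a real separable Hilbert space with inner product $\langle\cdot,\cdot\rangle$; $\Phi\subseteq H$ is a dense subspace equipped with a topological vector space structure such that the embedding $\Phi\to H$ is continuous; $\Phi'$ is the dual of $\Phi$ with respect to the inner product of $H$, so $\Phi\subseteq H\subseteq\Phi'$ and $\langle\cdot,\cdot\rangle$ also denotes the duality pairing. $\Phi'$ carries the weak-$*$ topology and its Borel $\sigma$-algebra. $\sigma:H\times H\to\mathbb{R}$ is a continuous antisymmetric non-degenerate bilinear form and $J:H\to H$ is the bounded operator with $\sigma(u,v)=\langle u,Jv\rangle$ (so $J^T=-J$); $J$ maps $\Phi$ continuously to itself, hence extends to $\Phi'$. $\{e_n\}_{n\in\mathbb{N}}$ is a countable linearly independent subset of $\Phi$ such that $\mathrm{span}_{\mathbb{R}}\{e_j\}$ is dense in $H$. $\mathscr{C}^\infty_{c,cyl}(\Phi')$ is the set of $F:\Phi'\to\mathbb{R}$ of the form $F(u)=\varphi(\langle u,e_1\rangle,\dots,\langle u,e_n\rangle)$ with $n\in\mathbb{N}$, $\varphi\in\mathscr{C}_c^\infty(\mathbb{R}^n)$. The gradient is $\nabla F(u)=\sum_{j=1}^n\partial_j\varphi(\langle u,e_1\rangle,\dots,\langle u,e_n\rangle)\,e_j\in\Phi$ and the Poisson bracket is $\{F,G\}(u)=\langle\nabla F(u),J\nabla G(u)\rangle$.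 A Borel probability measure $\mu$ on $\Phi'$ is a $(\beta,X)$-KMS state if $\langle f,X(\cdot)\rangle$ is $\mu$-integrable for all $f\in\Phi$ and, for all $F,G\in\mathscr{C}^\infty_{c,cyl}(\Phi')$, $\int_{\Phi'}\{F,G\}(u)\,d\mu=\beta\int_{\Phi'}\langle\nabla F(u),X(u)\rangle\,G(u)\,d\mu$. *)

theory Defs
  imports "HOL-Probability.Probability"
begin

section \<open>The dual of a dense topological vector subspace\<close>

text \<open>
  The space \<open>\<Phi>\<close> is given by its topology \<open>T\<close>, whose carrier \<open>topspace T\<close> is a linear
  subspace of the Hilbert space.
\<close>

definition tvs_topology :: "'h::real_vector topology \<Rightarrow> bool" where
  "tvs_topology T \<longleftrightarrow>
     subspace (topspace T) \<and>
     continuous_map (prod_topology T T) T (\<lambda>(x, y). x + y) \<and>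
     continuous_map (prod_topology euclideanreal T) T (\<lambda>(c, x). c *\<^sub>R x)"

text \<open>
  Elements of \<open>\<Phi>'\<close> are continuous linear functionals on \<open>\<Phi>\<close>, taken to be \<open>undefined\<close>
  outside \<open>\<Phi>\<close> so that equality of functions is equality in \<open>\<Phi>'\<close>. The pairing
  \<open>\<langle>u, f\<rangle>\<close> is the application \<open>u f\<close>; a vector \<open>h\<close> of the Hilbert space is identified with
  \<open>\<lambda>f\<in>topspace T. f \<bullet> h\<close>.
\<close>

definition dual_space :: "'h::real_vector topology \<Rightarrow> ('h \<Rightarrow> real) set" where
  "dual_space T =
     {u \<in> extensional (topspace T).
        (\<forall>f\<in>topspace T. \<forall>g\<in>topspace T. u (f + g) = u f + u g) \<and>
        (\<forall>c. \<forall>f\<in>topspace T. u (c *\<^sub>R f) = c * u f) \<and>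
        continuous_map T euclideanreal u}"

text \<open>Topology of pointwise convergence on \<open>\<Phi>\<close>.\<close>

definition weak_star :: "'h::real_vector topology \<Rightarrow> ('h \<Rightarrow> real) topology" where
  "weak_star T = subtopology (powertop_real (topspace T)) (dual_space T)"

definition dual_borel :: "'h::real_vector topology \<Rightarrow> ('h \<Rightarrow> real) measure" where
  "dual_borel T = sigma (topspace (weak_star T)) {U. openin (weak_star T) U}"

locale kms_setting =
  fixes T :: "'h::{real_inner, complete_space} topology"
    and \<sigma> :: "'h \<Rightarrow> 'h \<Rightarrow> real"
    and J :: "'h \<Rightarrow> 'h"
    and e :: "nat \<Rightarrow> 'h"
  assumes separable: "separable_space (euclidean :: 'h topology)"
    and tvs: "tvs_topology T"
    and dense: "closure (topspace T) = UNIV"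
    and embedding: "continuous_map T euclidean (\<lambda>x. x)"
    and sigma_bilinear: "bounded_bilinear \<sigma>"
    and sigma_antisym: "\<And>u v. \<sigma> u v = - \<sigma> v u"
    and sigma_nondeg: "\<And>u. (\<forall>v. \<sigma> u v = 0) \<Longrightarrow> u = 0"
    and J_bounded: "bounded_linear J"
    and J_sigma: "\<And>u v. \<sigma> u v = u \<bullet> J v"
    and J_continuous: "continuous_map T T J"
    and e_in: "range e \<subseteq> topspace T"
    and e_inj: "inj e"
    and e_independent: "independent (range e)"
    and e_total: "closure (span (range e)) = UNIV"

section \<open>Smooth compactly supported functions on \<open>\<real>\<^sup>n\<close>\<close>

text \<open>
  \<open>\<real>\<^sup>n\<close> is \<^term>\<open>Euclidean_space n\<close>: sequences with \<open>x i = 0\<close> for \<open>i \<ge> n\<close>. The coordinates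
  are numbered \<open>0, \<dots>, n - 1\<close>, and likewise the family \<open>e\<close> starts with \<open>e 0\<close>.
\<close>

definition partial_deriv :: "nat \<Rightarrow> ((nat \<Rightarrow> real) \<Rightarrow> real) \<Rightarrow> (nat \<Rightarrow> real) \<Rightarrow> real" where
  "partial_deriv j \<phi> x = deriv (\<lambda>t. \<phi> (x(j := t))) (x j)"

text \<open>All iterated partial derivatives exist and are continuous.\<close>

definition smooth_on_Rn :: "nat \<Rightarrow> ((nat \<Rightarrow> real) \<Rightarrow> real) \<Rightarrow> bool" where
  "smooth_on_Rn n \<phi> \<longleftrightarrow>
     (\<forall>js. set js \<subseteq> {..<n} \<longrightarrow>
        continuous_map (Euclidean_space n) euclideanreal (foldr partial_deriv js \<phi>) \<and>
        (\<forall>j<n. \<forall>x\<in>topspace (Euclidean_space n).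
           (\<lambda>t. foldr partial_deriv js \<phi> (x(j := t))) differentiable (at (x j))))"

definition Cc_infty :: "nat \<Rightarrow> ((nat \<Rightarrow> real) \<Rightarrow> real) set" where
  "Cc_infty n =
     {\<phi>. smooth_on_Rn n \<phi> \<and>
         compactin (Euclidean_space n)
           (Euclidean_space n closure_of {x \<in> topspace (Euclidean_space n). \<phi> x \<noteq> 0})}"

section \<open>Cylindrical functions, gradient and Poisson bracket\<close>

definition coords :: "(nat \<Rightarrow> 'h) \<Rightarrow> nat \<Rightarrow> ('h \<Rightarrow> real) \<Rightarrow> nat \<Rightarrow> real" where
  "coords e n u = (\<lambda>i. if i < n then u (e i) else 0)"

definition cyl :: "'h::real_vector topology \<Rightarrow> (nat \<Rightarrow> 'h) \<Rightarrow> nat \<Rightarrow> ((nat \<Rightarrow> real) \<Rightarrow> real)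
    \<Rightarrow> ('h \<Rightarrow> real) \<Rightarrow> real" where
  "cyl T e n \<phi> = (\<lambda>u\<in>dual_space T. \<phi> (coords e n u))"

definition cyl_functions ::
    "'h::real_vector topology \<Rightarrow> (nat \<Rightarrow> 'h) \<Rightarrow> (('h \<Rightarrow> real) \<Rightarrow> real) set" where
  "cyl_functions T e = {cyl T e n \<phi> | n \<phi>. n \<ge> 1 \<and> \<phi> \<in> Cc_infty n}"

text \<open>
  The gradient is given by a representation \<open>F = cyl T e n \<phi>\<close>; it does not depend on the
  representation, see \<open>cyl_grad_eq\<close> below.
\<close>

definition cyl_grad :: "'h::real_vector topology \<Rightarrow> (nat \<Rightarrow> 'h)
    \<Rightarrow> (('h \<Rightarrow> real) \<Rightarrow> real) \<Rightarrow> ('h \<Rightarrow> real) \<Rightarrow> 'h" where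
  "cyl_grad T e F u =
     (THE v. \<exists>n \<phi>. n \<ge> 1 \<and> \<phi> \<in> Cc_infty n \<and> F = cyl T e n \<phi> \<and>
        v = (\<Sum>j<n. partial_deriv j \<phi> (coords e n u) *\<^sub>R e j))"

definition poisson :: "'h::real_inner topology \<Rightarrow> ('h \<Rightarrow> 'h) \<Rightarrow> (nat \<Rightarrow> 'h)
    \<Rightarrow> (('h \<Rightarrow> real) \<Rightarrow> real) \<Rightarrow> (('h \<Rightarrow> real) \<Rightarrow> real) \<Rightarrow> ('h \<Rightarrow> real) \<Rightarrow> real" where
  "poisson T J e F G u = cyl_grad T e F u \<bullet> J (cyl_grad T e G u)"

lemma orthogonal_projection_exists:
  fixes B :: "'a::real_inner set"
  assumes "finite B"
  shows "\<exists>y\<in>span B. \<forall>b\<in>B. (x - y) \<bullet> b = 0"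
  using assms
proof (induction B arbitrary: x rule: finite_induct)
  case empty
  then show ?case by auto
next
  case (insert b B)
  obtain y where y: "y \<in> span B" "\<And>c. c \<in> B \<Longrightarrow> (x - y) \<bullet> c = 0"
    using insert.IH by blast
  obtain p where p: "p \<in> span B" "\<And>c. c \<in> B \<Longrightarrow> (b - p) \<bullet> c = 0"
    using insert.IH by blast
  have orth: "z \<bullet> w = 0" if "w \<in> span B" "\<And>c. c \<in> B \<Longrightarrow> z \<bullet> c = 0" for z w
    using that(1)
  proof (induction rule: span_induct_alt)
    case base
    then show ?case by simp
  next
    case (step c a w)
    then show ?case using that(2) by (simp add: inner_right_distrib)
  qed
  define d where "d = b - p"
  define y' where "y' = y + ((x \<bullet> d) / (d \<bullet> d)) *\<^sub>R d"
  have "y' \<in> span (insert b B)"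
    unfolding y'_def d_def using y(1) p(1)
    by (meson insertI1 span_add span_base span_diff span_mono span_scale subset_insertI subsetD)
  moreover have "(x - y') \<bullet> c = 0" if "c \<in> B" for c
    using y(2)[OF that] p(2)[OF that]
    by (simp add: y'_def d_def inner_diff_left inner_add_left)
  moreover have "(x - y') \<bullet> b = 0"
  proof -
    have "(x - y') \<bullet> p = 0"
      using orth[OF p(1)] calculation(2) by blast
    moreover have "(x - y') \<bullet> d = 0"
    proof -
      have "y \<bullet> d = 0"
        using orth[OF y(1), of d] p(2) by (simp add: d_def inner_commute)
      then show ?thesis
        by (cases "d = 0") (simp_all add: y'_def inner_diff_left inner_add_left)
    qed
    ultimately show ?thesis
      by (simp add: d_def inner_diff_right)
  qed
  ultimately show ?case by blast
qed

context kms_setting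
begin

lemma biorthogonal_exists:
  assumes "k < N"
  shows "\<exists>h. \<forall>j<N. e j \<bullet> h = (if j = k then 1 else 0)"
proof -
  let ?B = "e ` ({..<N} - {k})"
  obtain y where y: "y \<in> span ?B" "\<And>b. b \<in> ?B \<Longrightarrow> (e k - y) \<bullet> b = 0"
    using orthogonal_projection_exists[of ?B "e k"] by auto
  have "e k \<notin> span (range e - {e k})"
    using e_independent unfolding dependent_def by blast
  moreover have "?B \<subseteq> range e - {e k}"
    using e_inj by (auto simp: inj_def)
  ultimately have nz: "e k - y \<noteq> 0"
    using y(1) span_mono[of ?B] by (metis (no_types) eq_iff_diff_eq_0 subsetD)
  define d where "d = e k - y"
  have orth: "d \<bullet> b = 0" if "b \<in> ?B" for b
    using y(2)[OF that] by (simp add: d_def)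
  have "d \<bullet> y = 0"
    using y(1)
  proof (induction rule: span_induct_alt)
    case base
    then show ?case by simp
  next
    case (step c a w)
    then show ?case using orth by (simp add: inner_right_distrib)
  qed
  then have dk: "d \<bullet> e k = d \<bullet> d"
    by (simp add: d_def inner_diff_right)
  have "e j \<bullet> ((1 / (d \<bullet> d)) *\<^sub>R d) = (if j = k then 1 else 0)" if "j < N" for j
    using orth[of "e j"] that dk nz by (auto simp: inner_commute d_def)
  then show ?thesis by blast
qed

lemma dual_space_shift:
  assumes "u \<in> dual_space T"
  shows "(\<lambda>f\<in>topspace T. u f + t * (f \<bullet> h)) \<in> dual_space T"
proof -
  have sub: "subspace (topspace T)"
    using tvs by (simp add: tvs_topology_def)
  have "continuous_map euclidean euclideanreal (\<lambda>f. f \<bullet> h)"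
    by (simp add: continuous_on_inner)
  then have "continuous_map T euclideanreal (\<lambda>f. f \<bullet> h)"
    using continuous_map_compose[OF embedding, of euclideanreal "\<lambda>f. f \<bullet> h"] by (simp add: o_def)
  then have "continuous_map T euclideanreal (\<lambda>f. t * (f \<bullet> h))"
    by (rule continuous_map_real_mult_left)
  moreover have "continuous_map T euclideanreal u"
    using assms by (simp add: dual_space_def)
  ultimately have "continuous_map T euclideanreal (\<lambda>f. u f + t * (f \<bullet> h))"
    using continuous_map_add by blast
  then have "continuous_map T euclideanreal (\<lambda>f\<in>topspace T. u f + t * (f \<bullet> h))"
    by (rule continuous_map_eq) auto
  then show ?thesis
    using assms sub unfolding dual_space_def
    by (auto simp: subspace_add subspace_scale inner_add_left algebra_simps)
qed

lemma partial_deriv_eq_directional: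
  assumes u: "u \<in> dual_space T"
    and h: "\<And>j. j < N \<Longrightarrow> e j \<bullet> h = (if j = k then 1 else 0)"
    and "n \<le> N"
  shows "deriv (\<lambda>t. cyl T e n \<phi> (\<lambda>f\<in>topspace T. u f + (t - u (e k)) * (f \<bullet> h))) (u (e k))
       = (if k < n then partial_deriv k \<phi> (coords e n u) else 0)"
proof -
  have "coords e n (\<lambda>f\<in>topspace T. u f + (t - u (e k)) * (f \<bullet> h))
      = (if k < n then (coords e n u)(k := t) else coords e n u)" for t
    using e_in h \<open>n \<le> N\<close> by (auto simp: coords_def fun_eq_iff)
  then have "(\<lambda>t. cyl T e n \<phi> (\<lambda>f\<in>topspace T. u f + (t - u (e k)) * (f \<bullet> h)))
      = (\<lambda>t. \<phi> (if k < n then (coords e n u)(k := t) else coords e n u))"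
    using dual_space_shift[OF u] by (simp add: cyl_def)
  then show ?thesis
    by (simp add: partial_deriv_def coords_def)
qed

lemma cyl_grad_eq:
  assumes "n \<ge> 1" "\<phi> \<in> Cc_infty n" and u: "u \<in> dual_space T"
  shows "cyl_grad T e (cyl T e n \<phi>) u = (\<Sum>j<n. partial_deriv j \<phi> (coords e n u) *\<^sub>R e j)"
proof -
  have "(\<Sum>j<m. partial_deriv j \<psi> (coords e m u) *\<^sub>R e j)
      = (\<Sum>j<n. partial_deriv j \<phi> (coords e n u) *\<^sub>R e j)"
    if eq: "cyl T e n \<phi> = cyl T e m \<psi>" for m \<psi>
  proof -
    define N where "N = max n m"
    have pad: "(\<Sum>j<l. c j *\<^sub>R e j) = (\<Sum>j<N. (if j < l then c j else 0) *\<^sub>R e j)"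
      if "l \<le> N" for l and c :: "nat \<Rightarrow> real"
      using that by (intro sum.mono_neutral_cong_left) auto
    have "(if k < n then partial_deriv k \<phi> (coords e n u) else 0)
        = (if k < m then partial_deriv k \<psi> (coords e m u) else 0)" if k: "k < N" for k
    proof -
      obtain h where h: "\<And>j. j < N \<Longrightarrow> e j \<bullet> h = (if j = k then 1 else 0)"
        using biorthogonal_exists[OF k] by blast
      show ?thesis
        using partial_deriv_eq_directional[OF u h, of N n \<phi>]
          partial_deriv_eq_directional[OF u h, of N m \<psi>]
        by (simp add: eq N_def)
    qed
    then show ?thesis
      using pad[of n] pad[of m] by (simp add: N_def)
  qed
  then show ?thesis
    unfolding cyl_grad_def using assms(1,2) by (intro the_equality) blast+
qed

end

section \<open>KMS states\<close>

text \<open>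
  For Borel \<open>X\<close> with the required integrability, both integrands below are integrable, so the
  value \<open>0\<close> of the Bochner integral at non-integrable functions plays no role.
\<close>

definition KMS_states :: "'h::real_inner topology \<Rightarrow> ('h \<Rightarrow> 'h) \<Rightarrow> (nat \<Rightarrow> 'h) \<Rightarrow> real
    \<Rightarrow> (('h \<Rightarrow> real) \<Rightarrow> ('h \<Rightarrow> real)) \<Rightarrow> ('h \<Rightarrow> real) measure set" where
  "KMS_states T J e \<beta> X =
     {\<mu> \<in> space (prob_algebra (dual_borel T)).
        (\<forall>f\<in>topspace T. integrable \<mu> (\<lambda>u. X u f)) \<and>
        (\<forall>F\<in>cyl_functions T e. \<forall>G\<in>cyl_functions T e.
           (\<integral>u. poisson T J e F G u \<partial>\<mu>) = \<beta> * (\<integral>u. X u (cyl_grad T e F u) * G u \<partial>\<mu>))}"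

definition mixture :: "real \<Rightarrow> 'a measure \<Rightarrow> 'a measure \<Rightarrow> 'a measure" where
  "mixture t \<mu> \<nu> = measure_of (space \<mu>) (sets \<mu>)
     (\<lambda>A. ennreal (1 - t) * emeasure \<mu> A + ennreal t * emeasure \<nu> A)"

definition convex_measures :: "'a measure set \<Rightarrow> bool" where
  "convex_measures K \<longleftrightarrow> (\<forall>\<mu>\<in>K. \<forall>\<nu>\<in>K. \<forall>t\<in>{0..1}. mixture t \<mu> \<nu> \<in> K)"

text \<open>
  \<^const>\<open>measure_of\<close> yields the null measure when its argument is not a measure; this does not
  happen in \<open>mixture\<close> for measures on the same \<open>\<sigma>\<close>-algebra.
\<close>

lemma emeasure_mixture:
  assumes "sets \<mu> = sets \<nu>" "A \<in> sets \<mu>"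
  shows "emeasure (mixture t \<mu> \<nu>) A = ennreal (1 - t) * emeasure \<mu> A + ennreal t * emeasure \<nu> A"
  unfolding mixture_def
proof (rule emeasure_measure_of_sigma)
  show "countably_additive (sets \<mu>)
      (\<lambda>A. ennreal (1 - t) * emeasure \<mu> A + ennreal t * emeasure \<nu> A)"
    using assms(1)
    by (auto simp: countably_additive_def suminf_add[symmetric] ennreal_suminf_cmult
        suminf_emeasure image_subset_iff)
  show "sigma_algebra (space \<mu>) (sets \<mu>)"
    by (rule sets.sigma_algebra_axioms)
qed (use assms in \<open>auto simp: positive_def\<close>)

end

theory Submission
  imports Defs
begin

text \<open>
  Both sides of the KMS identity are affine in the measure as soon as the integrands are
  integrable. The Poisson bracket of cylindrical functions is a finite sum of bounded continuous
  functions, and the right-hand integrand is a finite sum of products of bounded continuous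
  functions with the integrable functions \<open>\<langle>e\<^sub>j, X(\<cdot>)\<rangle>\<close>.
\<close>

section \<open>Integration against convex combinations of measures\<close>

lemma space_mixture [simp]: "space (mixture t \<mu> \<nu>) = space \<mu>"
  by (simp add: mixture_def)

lemma sets_mixture [simp, measurable_cong]: "sets (mixture t \<mu> \<nu>) = sets \<mu>"
  by (simp add: mixture_def)

text \<open>Measurable functions with values in \<open>ennreal\<close> are built from indicators by
  scaling, addition and increasing limits. For indicators the formula is
  \<open>emeasure_mixture\<close>, and each construction step preserves it.\<close>

lemma nn_integral_mixture:
  assumes s: "sets \<mu> = sets \<nu>" and f: "f \<in> borel_measurable \<mu>"
  shows "(\<integral>\<^sup>+x. f x \<partial>mixture t \<mu> \<nu>) =
    ennreal (1 - t) * (\<integral>\<^sup>+x. f x \<partial>\<mu>) + ennreal t * (\<integral>\<^sup>+x. f x \<partial>\<nu>)"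
  using f
proof (induction rule: borel_measurable_induct)
  case (cong f g)
  moreover have "space \<nu> = space \<mu>"
    using sets_eq_imp_space_eq[OF s] by simp
  ultimately show ?case
    using nn_integral_cong[of "mixture t \<mu> \<nu>" f g] nn_integral_cong[of \<mu> f g]
      nn_integral_cong[of \<nu> f g]
    by simp
next
  case (set A)
  then show ?case
    using s by (simp add: emeasure_mixture)
next
  case (mult u c)
  then show ?case
    using s by (simp add: nn_integral_cmult measurable_cong_sets[OF s refl, symmetric]
        measurable_cong_sets[OF sets_mixture refl] algebra_simps)
next
  case (add u v)
  then show ?case
    using s by (simp add: nn_integral_add measurable_cong_sets[OF s refl, symmetric]
        measurable_cong_sets[OF sets_mixture refl] algebra_simps)
next
  case (seq U)
  \<comment> \<open>Splitting the supremum of a sum into a sum of suprema requires both scaled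
    sequences of integrals to be increasing.\<close>
  have inc: "incseq (\<lambda>i. c * integral\<^sup>N M (U i))" for c :: ennreal and M
    using seq(3) by (auto simp: incseq_def le_fun_def intro!: mult_left_mono nn_integral_mono)
  \<comment> \<open>Monotone convergence is stated for an arbitrary \<open>M\<close> so that it
    serves the mixture and both of its components.\<close>
  have "(\<integral>\<^sup>+x. (SUP i. U i) x \<partial>M) = (SUP i. integral\<^sup>N M (U i))" if "sets M = sets \<mu>" for M
    using nn_integral_monotone_convergence_SUP[OF seq(3), of M] seq(1)
    by (simp add: measurable_cong_sets[OF that refl] image_comp)
  then show ?case
    using s seq.IH by (simp add: SUP_mult_left_ennreal ennreal_SUP_add inc)
qed

text \<open>The norm has finite integral under both components, hence under the mixture. The value
  of the integral then comes from the nonnegative integrals of \<open>f\<close> and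
  \<open>- f\<close>.\<close>

lemma
  fixes f :: "'a \<Rightarrow> real"
  assumes s: "sets \<mu> = sets \<nu>" and t: "t \<in> {0..1}"
    and f: "integrable \<mu> f" "integrable \<nu> f"
  shows integrable_mixture: "integrable (mixture t \<mu> \<nu>) f"
    and integral_mixture:
      "(\<integral>x. f x \<partial>mixture t \<mu> \<nu>) = (1 - t) * (\<integral>x. f x \<partial>\<mu>) + t * (\<integral>x. f x \<partial>\<nu>)"
proof -
  have m [measurable]: "f \<in> borel_measurable \<mu>"
    using f(1) by auto
  have m': "f \<in> borel_measurable (mixture t \<mu> \<nu>)"
    by measurable
  have fin: "(\<integral>\<^sup>+x. ennreal (norm (f x)) \<partial>\<mu>) < \<infinity>" "(\<integral>\<^sup>+x. ennreal (norm (f x)) \<partial>\<nu>) < \<infinity>"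
    using f by (auto simp: integrable_iff_bounded)
  show i: "integrable (mixture t \<mu> \<nu>) f"
    using fin m' by (simp add: integrable_iff_bounded nn_integral_mixture[OF s] ennreal_mult_less_top)
  \<comment> \<open>Since \<open>ennreal\<close> sends negative reals to 0, taking \<open>g\<close>
    to be \<open>f\<close> and then \<open>- f\<close> yields the positive and the negative part.
    Finiteness matters because \<open>enn2real\<close> maps infinity to 0 and is additive only on
    finite values.\<close>
  have pos: "enn2real (\<integral>\<^sup>+x. ennreal (g x) \<partial>mixture t \<mu> \<nu>) =
      (1 - t) * enn2real (\<integral>\<^sup>+x. ennreal (g x) \<partial>\<mu>) + t * enn2real (\<integral>\<^sup>+x. ennreal (g x) \<partial>\<nu>)"
    if g: "integrable \<mu> g" "integrable \<nu> g" for g :: "'a \<Rightarrow> real"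
  proof -
    have [measurable]: "g \<in> borel_measurable \<mu>"
      using g(1) by auto
    have "(\<integral>\<^sup>+x. ennreal (g x) \<partial>M) < \<infinity>" if "integrable M g" for M
      using integrableD(2)[OF that] by (simp add: top.not_eq_extremum)
    from this[OF g(1)] this[OF g(2)] show ?thesis
      using t by (simp add: nn_integral_mixture[OF s] enn2real_plus enn2real_mult ennreal_mult_less_top)
  qed
  show "(\<integral>x. f x \<partial>mixture t \<mu> \<nu>) = (1 - t) * (\<integral>x. f x \<partial>\<mu>) + t * (\<integral>x. f x \<partial>\<nu>)"
    using pos[of f] pos[of "\<lambda>x. - f x"] f
    by (simp add: real_lebesgue_integral_def i algebra_simps)
qed

lemma mixture_in_prob_algebra:
  assumes "\<mu> \<in> space (prob_algebra M)" "\<nu> \<in> space (prob_algebra M)" and t: "t \<in> {0..1}"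
  shows "mixture t \<mu> \<nu> \<in> space (prob_algebra M)"
proof -
  have s: "sets \<mu> = sets M" "sets \<nu> = sets M" and p: "prob_space \<mu>" "prob_space \<nu>"
    using assms(1,2) by (auto simp: space_prob_algebra)
  have "space \<nu> = space \<mu>"
    using s sets_eq_imp_space_eq by metis
  then have "emeasure (mixture t \<mu> \<nu>) (space \<mu>) = ennreal (1 - t) + ennreal t"
    using s prob_space.emeasure_space_1[OF p(1)] prob_space.emeasure_space_1[OF p(2)]
    by (simp add: emeasure_mixture[OF _ sets.top])
  also have "\<dots> = 1"
    using t by (simp flip: ennreal_plus)
  finally show ?thesis
    using s by (auto simp: space_prob_algebra intro!: prob_spaceI)
qed

section \<open>Boundedness of test functions and their partial derivatives\<close>

lemma continuous_map_fun_upd_Euclidean_space: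
  assumes "x \<in> topspace (Euclidean_space n)" "j < n"
  shows "continuous_map euclideanreal (Euclidean_space n) (\<lambda>t. x(j := t))"
  \<comment> \<open>Because \<open>j < n\<close>, the update leaves the vanishing coordinates from
    \<open>n\<close> on untouched, so the line stays in the space.\<close>
  using assms
  by (auto simp: Euclidean_space_def continuous_map_in_subtopology continuous_map_componentwise_UNIV)

lemma Cc_infty_continuous:
  assumes "\<phi> \<in> Cc_infty n"
  shows "continuous_map (Euclidean_space n) euclideanreal \<phi>"
  using assms by (auto simp: Cc_infty_def smooth_on_Rn_def dest: spec[of _ "[]"])

lemma Cc_infty_partial_deriv_continuous:
  assumes "\<phi> \<in> Cc_infty n" "j < n"
  shows "continuous_map (Euclidean_space n) euclideanreal (partial_deriv j \<phi>)"
  using assms by (auto simp: Cc_infty_def smooth_on_Rn_def dest: spec[of _ "[j]"])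

text \<open>The complement of the support is open, so along the coordinate line through
  \<open>x\<close> the function vanishes near \<open>x j\<close>, and a derivative depends only on
  the values nearby.\<close>

lemma partial_deriv_eq_0_outside_support:
  fixes n \<phi>
  defines "S \<equiv> Euclidean_space n closure_of {x \<in> topspace (Euclidean_space n). \<phi> x \<noteq> 0}"
  assumes "j < n" "x \<in> topspace (Euclidean_space n)" "x \<notin> S"
  shows "partial_deriv j \<phi> x = 0"
proof -
  let ?E = "Euclidean_space n"
  let ?V = "{t. x(j := t) \<in> topspace ?E - S}"
  note c = continuous_map_fun_upd_Euclidean_space[OF assms(3,2)]
  have "openin ?E (topspace ?E - S)"
    unfolding S_def by (intro openin_diff openin_topspace closedin_closure_of)
  from openin_continuous_map_preimage[OF c this] have "open ?V"
    by simp
  moreover have "x j \<in> ?V"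
    using assms by simp
  moreover have "\<phi> (x(j := t)) = 0" if "t \<in> ?V" for t
    using that closure_of_subset[of "{x \<in> topspace ?E. \<phi> x \<noteq> 0}" ?E] unfolding S_def by blast
  ultimately have "\<forall>\<^sub>F t in nhds (x j). \<phi> (x(j := t)) = 0"
    unfolding eventually_nhds by blast
  then have "deriv (\<lambda>t. \<phi> (x(j := t))) (x j) = deriv (\<lambda>t. 0) (x j)"
    by (intro deriv_cong_ev) auto
  then show ?thesis
    by (simp add: partial_deriv_def)
qed

lemma continuous_map_bounded_if_compactin_support:
  fixes g :: "'a \<Rightarrow> real"
  assumes g: "continuous_map E euclideanreal g" and K: "compactin E K"
    and z: "\<And>x. x \<in> topspace E \<Longrightarrow> x \<notin> K \<Longrightarrow> g x = 0"
  shows "\<exists>B. \<forall>x\<in>topspace E. \<bar>g x\<bar> \<le> B"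
proof -
  have "compact (g ` K)"
    using image_compactin[OF K g] by simp
  then obtain B where "\<forall>y\<in>g ` K. norm y \<le> B"
    using compact_imp_bounded bounded_iff by metis
  \<comment> \<open>For empty \<open>K\<close> the constant \<open>B\<close> may be negative; the
    maximum with 0 also covers the points outside \<open>K\<close>.\<close>
  then have "\<bar>g x\<bar> \<le> max B 0" if "x \<in> topspace E" for x
    using z[OF that] by (cases "x \<in> K") (auto simp: le_max_iff_disj)
  then show ?thesis
    by blast
qed

lemma Cc_infty_bounded:
  assumes "\<phi> \<in> Cc_infty n"
  shows "\<exists>B. \<forall>x\<in>topspace (Euclidean_space n). \<bar>\<phi> x\<bar> \<le> B"
proof (rule continuous_map_bounded_if_compactin_support[OF Cc_infty_continuous[OF assms]])
  let ?A = "{x \<in> topspace (Euclidean_space n). \<phi> x \<noteq> 0}"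
  show "compactin (Euclidean_space n) (Euclidean_space n closure_of ?A)"
    using assms by (simp add: Cc_infty_def)
  show "\<phi> x = 0" if "x \<in> topspace (Euclidean_space n)" "x \<notin> Euclidean_space n closure_of ?A" for x
    using that closure_of_subset[of ?A "Euclidean_space n"] by blast
qed

lemma Cc_infty_partial_deriv_bounded:
  assumes "\<phi> \<in> Cc_infty n" "j < n"
  shows "\<exists>B. \<forall>x\<in>topspace (Euclidean_space n). \<bar>partial_deriv j \<phi> x\<bar> \<le> B"
proof (rule continuous_map_bounded_if_compactin_support[OF Cc_infty_partial_deriv_continuous[OF assms]])
  let ?A = "{x \<in> topspace (Euclidean_space n). \<phi> x \<noteq> 0}"
  show "compactin (Euclidean_space n) (Euclidean_space n closure_of ?A)"
    using assms(1) by (simp add: Cc_infty_def)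
  show "partial_deriv j \<phi> x = 0"
    if "x \<in> topspace (Euclidean_space n)" "x \<notin> Euclidean_space n closure_of ?A" for x
    using partial_deriv_eq_0_outside_support[OF assms(2) that] .
qed

section \<open>Borel measurability on the dual with its weak-* topology\<close>

lemma topspace_weak_star [simp]: "topspace (weak_star T) = dual_space T"
  \<comment> \<open>Elements of the dual are extensional, hence already points of the product
    space.\<close>
  by (auto simp: weak_star_def dual_space_def PiE_def)

lemma space_dual_borel [simp]: "space (dual_borel T) = dual_space T"
  by (simp add: dual_borel_def space_measure_of_conv)

lemma borel_measurable_dual_borel:
  fixes g :: "('h::real_vector \<Rightarrow> real) \<Rightarrow> real"
  assumes "continuous_map (weak_star T) euclideanreal g"
  shows "g \<in> borel_measurable (dual_borel T)"
proof (rule borel_measurableI)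
  fix S :: "real set" assume "open S"
  then have "openin (weak_star T) {u \<in> topspace (weak_star T). g u \<in> S}"
    using openin_continuous_map_preimage[OF assms] by simp
  moreover have "g -` S \<inter> space (dual_borel T) = {u \<in> topspace (weak_star T). g u \<in> S}"
    by auto
  moreover have "{U. openin (weak_star T) U} \<subseteq> Pow (topspace (weak_star T))"
    using openin_subset by blast
  ultimately show "g -` S \<inter> space (dual_borel T) \<in> sets (dual_borel T)"
    by (simp add: dual_borel_def sets_measure_of)
qed

lemma coords_in_Euclidean_space: "coords e n u \<in> topspace (Euclidean_space n)"
  by (simp add: topspace_Euclidean_space coords_def)

text \<open>The weak-* topology is induced by a product topology, whose projections are the
  evaluations at vectors of \<open>topspace T\<close>. Each coordinate is such an evaluation or
  constantly 0.\<close>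

lemma continuous_map_coords:
  assumes "range e \<subseteq> topspace T"
  shows "continuous_map (weak_star T) (Euclidean_space n) (coords e n)"
proof -
  have "continuous_map (weak_star T) euclideanreal (\<lambda>u. coords e n u k)" for k
    using assms unfolding weak_star_def coords_def
    by (cases "k < n")
      (auto intro!: continuous_map_from_subtopology continuous_map_product_projection)
  then show ?thesis
    using coords_in_Euclidean_space[of e n]
    by (auto simp: Euclidean_space_def continuous_map_in_subtopology
        continuous_map_componentwise_UNIV)
qed

section \<open>Integrability of both sides of the KMS identity\<close>

context kms_setting
begin

lemma borel_measurable_comp_coords:
  assumes "continuous_map (Euclidean_space n) euclideanreal g"
  shows "(\<lambda>u. g (coords e n u)) \<in> borel_measurable (dual_borel T)"
  using continuous_map_compose[OF continuous_map_coords[OF e_in] assms]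
  by (intro borel_measurable_dual_borel) (simp add: o_def)

text \<open>Elements of the dual are linear only on \<open>topspace T\<close>, so the induction has
  to keep every partial sum inside that subspace.\<close>

lemma dual_space_sum:
  assumes u: "u \<in> dual_space T" and "finite A"
  shows "u (\<Sum>j\<in>A. c j *\<^sub>R e j) = (\<Sum>j\<in>A. c j * u (e j))"
proof -
  have sub: "subspace (topspace T)"
    using tvs by (simp add: tvs_topology_def)
  have e: "e j \<in> topspace T" for j
    using e_in by blast
  have ladd: "u (f + g) = u f + u g" if "f \<in> topspace T" "g \<in> topspace T" for f g
    using u that by (simp add: dual_space_def)
  have lscale: "u (c *\<^sub>R f) = c * u f" if "f \<in> topspace T" for c f
    using u that by (simp add: dual_space_def)
  show ?thesis
    using \<open>finite A\<close>
  proof induction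
    case empty
    then show ?case
      \<comment> \<open>The value at the zero vector comes from scaling the known member
        \<open>e 0\<close> by 0.\<close>
      using lscale[OF e[of 0], of 0] by simp
  next
    case (insert a A)
    have "(\<Sum>j\<in>A. c j *\<^sub>R e j) \<in> topspace T"
      using sub e by (intro subspace_sum subspace_scale) auto
    then show ?case
      using insert e sub by (simp add: ladd lscale subspace_scale)
  qed
qed

text \<open>Bilinearity turns the bracket into a finite double sum of products of partial
  derivatives with the constants \<open>e j \<bullet> J (e k)\<close>. These products are bounded
  and measurable, hence integrable for a probability measure.\<close>

lemma integrable_poisson:
  assumes \<mu>: "\<mu> \<in> space (prob_algebra (dual_borel T))"
    and F: "F \<in> cyl_functions T e" and G: "G \<in> cyl_functions T e"
  shows "integrable \<mu> (poisson T J e F G)"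
proof -
  interpret prob_space \<mu>
    using \<mu> by (simp add: space_prob_algebra)
  have s: "sets \<mu> = sets (dual_borel T)"
    using \<mu> by (simp add: space_prob_algebra)
  have sp: "space \<mu> = dual_space T"
    using sets_eq_imp_space_eq[OF s] by simp
  obtain n \<phi> where F: "n \<ge> 1" "\<phi> \<in> Cc_infty n" "F = cyl T e n \<phi>"
    using F by (auto simp: cyl_functions_def)
  obtain m \<psi> where G: "m \<ge> 1" "\<psi> \<in> Cc_infty m" "G = cyl T e m \<psi>"
    using G by (auto simp: cyl_functions_def)
  let ?p = "\<lambda>j u. partial_deriv j \<phi> (coords e n u)" and ?q = "\<lambda>k u. partial_deriv k \<psi> (coords e m u)"
  have "integrable \<mu> (\<lambda>u. ?p j u * ?q k u)" if jk: "j < n" "k < m" for j k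
  proof -
    obtain B where B: "\<forall>x\<in>topspace (Euclidean_space n). \<bar>partial_deriv j \<phi> x\<bar> \<le> B"
      using Cc_infty_partial_deriv_bounded[OF F(2) jk(1)] by blast
    obtain C where C: "\<forall>x\<in>topspace (Euclidean_space m). \<bar>partial_deriv k \<psi> x\<bar> \<le> C"
      using Cc_infty_partial_deriv_bounded[OF G(2) jk(2)] by blast
    have [measurable]: "?p j \<in> borel_measurable \<mu>" "?q k \<in> borel_measurable \<mu>"
      using F G jk by (simp_all add: measurable_cong_sets[OF s refl]
          borel_measurable_comp_coords Cc_infty_partial_deriv_continuous)
    have "\<bar>?p j u * ?q k u\<bar> \<le> B * C" for u
      using B C coords_in_Euclidean_space[of e n u] coords_in_Euclidean_space[of e m u]
      unfolding abs_mult by (intro mult_mono') auto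
    then show ?thesis
      by (intro integrable_const_bound[of _ "B * C"]) auto
  qed
  then have "integrable \<mu> (\<lambda>u. \<Sum>j<n. \<Sum>k<m. ?p j u * ?q k u * (e j \<bullet> J (e k)))"
    by (intro Bochner_Integration.integrable_sum integrable_mult_left) auto
  \<comment> \<open>The formula for the gradient is available for \<open>u\<close> in the dual,
    which is all of \<open>space \<mu>\<close>; integrability depends only on the values
    there.\<close>
  moreover have "poisson T J e F G u = (\<Sum>j<n. \<Sum>k<m. ?p j u * ?q k u * (e j \<bullet> J (e k)))"
    if "u \<in> space \<mu>" for u
    using that J_bounded F G
    by (subst sum.swap) (simp add: sp poisson_def cyl_grad_eq linear_sum bounded_linear.linear
        linear_scale inner_sum_left inner_sum_right sum_distrib_left mult_ac)
  ultimately show ?thesis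
    by (simp cong: Bochner_Integration.integrable_cong)
qed

text \<open>The vector to which \<open>X u\<close> is applied varies with \<open>u\<close>, whereas
  \<open>Xi\<close> concerns a fixed vector. Linearity of \<open>X u\<close> moves this dependence
  into bounded scalar factors and leaves only the integrable functions
  \<open>X u (e j)\<close>.\<close>

lemma integrable_cyl_grad_mult_cyl:
  assumes \<mu>: "\<mu> \<in> space (prob_algebra (dual_borel T))"
    and F: "F \<in> cyl_functions T e" and G: "G \<in> cyl_functions T e"
    and X: "X \<in> measurable (dual_borel T) (dual_borel T)"
    and Xi: "\<And>f. f \<in> topspace T \<Longrightarrow> integrable \<mu> (\<lambda>u. X u f)"
  shows "integrable \<mu> (\<lambda>u. X u (cyl_grad T e F u) * G u)"
proof -
  have s: "sets \<mu> = sets (dual_borel T)"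
    using \<mu> by (simp add: space_prob_algebra)
  have sp: "space \<mu> = dual_space T"
    using sets_eq_imp_space_eq[OF s] by simp
  obtain n \<phi> where F: "n \<ge> 1" "\<phi> \<in> Cc_infty n" "F = cyl T e n \<phi>"
    using F by (auto simp: cyl_functions_def)
  obtain m \<psi> where G: "m \<ge> 1" "\<psi> \<in> Cc_infty m" "G = cyl T e m \<psi>"
    using G by (auto simp: cyl_functions_def)
  let ?p = "\<lambda>j u. partial_deriv j \<phi> (coords e n u)" and ?q = "\<lambda>u. \<psi> (coords e m u)"
  have "integrable \<mu> (\<lambda>u. ?p j u * ?q u * X u (e j))" if j: "j < n" for j
  proof -
    obtain B where B: "\<forall>x\<in>topspace (Euclidean_space n). \<bar>partial_deriv j \<phi> x\<bar> \<le> B"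
      using Cc_infty_partial_deriv_bounded[OF F(2) j] by blast
    obtain C where C: "\<forall>x\<in>topspace (Euclidean_space m). \<bar>\<psi> x\<bar> \<le> C"
      using Cc_infty_bounded[OF G(2)] by blast
    have [measurable]: "?p j \<in> borel_measurable \<mu>" "?q \<in> borel_measurable \<mu>"
      using F G j by (simp_all add: measurable_cong_sets[OF s refl]
          borel_measurable_comp_coords Cc_infty_continuous Cc_infty_partial_deriv_continuous)
    have i: "integrable \<mu> (\<lambda>u. X u (e j))"
      using Xi e_in by auto
    then have [measurable]: "(\<lambda>u. X u (e j)) \<in> borel_measurable \<mu>"
      by auto
    \<comment> \<open>The absolute value of \<open>B * C\<close> is the form in which the constant
      enters the norm of the dominating function below.\<close>
    have b: "\<bar>?p j u * ?q u\<bar> \<le> \<bar>B * C\<bar>" for u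
      using B C coords_in_Euclidean_space[of e n u] coords_in_Euclidean_space[of e m u]
      unfolding abs_mult by (intro mult_mono') force+
    show ?thesis
    proof (rule Bochner_Integration.integrable_bound)
      show "integrable \<mu> (\<lambda>u. B * C * X u (e j))"
        using i by simp
      show "AE u in \<mu>. norm (?p j u * ?q u * X u (e j)) \<le> norm (B * C * X u (e j))"
        using mult_right_mono[OF b abs_ge_zero] by (simp add: abs_mult)
    qed measurable
  qed
  then have "integrable \<mu> (\<lambda>u. \<Sum>j<n. ?p j u * ?q u * X u (e j))"
    by (intro Bochner_Integration.integrable_sum) auto
  moreover have "X u (cyl_grad T e F u) * G u = (\<Sum>j<n. ?p j u * ?q u * X u (e j))"
    if u: "u \<in> space \<mu>" for u
  proof -
    \<comment> \<open>Here measurability of \<open>X\<close> is used for its target space: it makes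
      \<open>X u\<close> a linear functional.\<close>
    have "X u \<in> dual_space T"
      using measurable_space[OF X] u by (simp add: sp)
    then have "X u (cyl_grad T e F u) = (\<Sum>j<n. ?p j u * X u (e j))"
      using u F by (simp add: sp cyl_grad_eq dual_space_sum[of "X u"])
    moreover have "G u = ?q u"
      using u G(3) by (simp add: sp cyl_def)
    ultimately show ?thesis
      by (simp add: sum_distrib_left mult_ac)
  qed
  ultimately show ?thesis
    by (simp cong: Bochner_Integration.integrable_cong)
qed

section \<open>Stability of the KMS condition under mixtures\<close>

lemma mixture_in_KMS_states:
  assumes X: "X \<in> measurable (dual_borel T) (dual_borel T)"
    and \<mu>: "\<mu> \<in> KMS_states T J e \<beta> X" and \<nu>: "\<nu> \<in> KMS_states T J e \<beta> X"
    and t: "t \<in> {0..1}"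
  shows "mixture t \<mu> \<nu> \<in> KMS_states T J e \<beta> X"
proof -
  have p: "\<mu> \<in> space (prob_algebra (dual_borel T))" "\<nu> \<in> space (prob_algebra (dual_borel T))"
    using \<mu> \<nu> by (auto simp: KMS_states_def)
  then have s: "sets \<mu> = sets \<nu>"
    by (simp add: space_prob_algebra)
  have i: "integrable \<mu> (\<lambda>u. X u f)" "integrable \<nu> (\<lambda>u. X u f)" if "f \<in> topspace T" for f
    using \<mu> \<nu> that by (auto simp: KMS_states_def)
  have "(\<integral>u. poisson T J e F G u \<partial>mixture t \<mu> \<nu>) =
      \<beta> * (\<integral>u. X u (cyl_grad T e F u) * G u \<partial>mixture t \<mu> \<nu>)"
    if FG: "F \<in> cyl_functions T e" "G \<in> cyl_functions T e" for F G
  proof -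
    have "(\<integral>u. poisson T J e F G u \<partial>\<mu>) = \<beta> * (\<integral>u. X u (cyl_grad T e F u) * G u \<partial>\<mu>)"
      "(\<integral>u. poisson T J e F G u \<partial>\<nu>) = \<beta> * (\<integral>u. X u (cyl_grad T e F u) * G u \<partial>\<nu>)"
      using \<mu> \<nu> FG by (auto simp: KMS_states_def)
    then show ?thesis
      \<comment> \<open>Both integrals against the mixture split with weights \<open>1 - t\<close>
        and \<open>t\<close>, so the identity follows from the two given ones by distributing
        \<open>\<beta>\<close>.\<close>
      using integral_mixture[OF s t integrable_poisson[OF p(1) FG] integrable_poisson[OF p(2) FG]]
        integral_mixture[OF s t integrable_cyl_grad_mult_cyl[OF p(1) FG X i(1)]
          integrable_cyl_grad_mult_cyl[OF p(2) FG X i(2)]]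
      by (simp add: distrib_left mult.left_commute)
  qed
  then show ?thesis
    using mixture_in_prob_algebra[OF p t] integrable_mixture[OF s t i]
    by (simp add: KMS_states_def)
qed

end

theorem proposition2p6:
  fixes T :: "'h::{real_inner, complete_space} topology"
    and \<sigma> :: "'h \<Rightarrow> 'h \<Rightarrow> real"
    and J :: "'h \<Rightarrow> 'h"
    and e :: "nat \<Rightarrow> 'h"
    and X :: "('h \<Rightarrow> real) \<Rightarrow> ('h \<Rightarrow> real)"
    and \<beta> :: real
  assumes "kms_setting T \<sigma> J e"
    and "X \<in> measurable (dual_borel T) (dual_borel T)"
    and "\<beta> > 0"
  shows "KMS_states T J e \<beta> X \<subseteq> space (prob_algebra (dual_borel T)) \<and>
         convex_measures (KMS_states T J e \<beta> X)"
proof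
  show "KMS_states T J e \<beta> X \<subseteq> space (prob_algebra (dual_borel T))"
    by (auto simp: KMS_states_def)
  show "convex_measures (KMS_states T J e \<beta> X)"
    using kms_setting.mixture_in_KMS_states[OF assms(1,2)] by (simp add: convex_measures_def)
qed

end
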